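(* Let $\Sigma=\{\sigma_1,\dots,\sigma_m\}$ be a finite alphabet of size $m$, let $h:\Sigma^*\to\Sigma^*$ be a morphism, and put $N=\max_{\sigma\in\Sigma}|h(\sigma)|$. Suppose that $h(\sigma_1)=\sigma_1x$ for some non-empty word $x\in\Sigma^*$, and that $|h(\sigma_i)|>1$ for each $i\in\{1,\dots,m\}$. Let $k\ge2$ and let $\mathcal{I}$ be a factor of $h^\omega(\sigma_1)$ which is an instance of a $k$-template $$t=[a_1,a_2,\dots,a_{k+1},d_1,d_2,\dots,d_{k-1}],$$ and suppose that $$|\mathcal{I}|>N+k-1+(k-1)\Bigl(N-2+\max_{1\le i<j\le k}\Bigl|\sum_{r=i}^{j-1}d_r\cdot(1,\dots,1)\Bigr|\Bigr).$$ Then, for some parent $t_1$ of $t$ under $h$, the infinite word $h^\omega(\sigma_1)$ contains a factor $\mathcal{J}$ which is an instance of $t_1$ and satisfies $|\mathcal{J}|<|\mathcal{I}|$.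
   Context: $\Sigma^*$ is the free monoid of finite words over $\Sigma$, with empty word $\epsilon$, and $|u|$ is the length of $u$; a morphism is a monoid homomorphism. $h^\omega(\sigma_1)$ is the infinite word having every $h^n(\sigma_1)$ as a prefix. A factor is a contiguous finite subword. The Parikh vector $\psi(u)\in\mathbb{N}^m$ (a row vector) has $i$-th coordinate the number of occurrences of $\sigma_i$ in $u$. The frequency matrix $M$ of $h$ is the $m\times m$ matrix whose $i$-th row is $\psi(h(\sigma_i))$. The symbol $\cdot$ is the dot product and $(1,\dots,1)\in\mathbb{Z}^m$. For $k\ge2$, a $k$-template is a finite sequence $t=[a_1,\dots,a_{k+1},d_1,\dots,d_{k-1}]$ with $a_i\in\Sigma\cup\{\epsilon\}$ and $d_j\in\mathbb{Z}^m$. A word $w$ is an instance (realization) of $t$ if there are words $X_1,\dots,X_k\in\Sigma^*$ with $w=a_1X_1a_2X_2\cdots a_kX_ka_{k+1}$ and $\psi(X_{i+1})-\psi(X_i)=d_i$ for $i=1,\dots,k-1$. A parent of $t$ under $h$ is a $k$-template $t_p=[A_1,\dots,A_{k+1},D_1,\dots,D_{k-1}]$ such that there are words $p_i',p_i''\in\Sigma^*$ with $h(A_i)=p_i'a_ip_i''$ for $i\in\{1,\dots,k+1\}$ and $$\psi(p''_{j+1}p'_{j+2})-\psi(p''_jp'_{j+1})+D_jM=d_j\qquad\text{for } j\in\{1,\dots,k-1\}.$$ *)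

theory Defs
  imports "HOL-Analysis.Finite_Cartesian_Product" "HOL-Library.Omega_Words_Fun"
begin

text \<open>
  The alphabet \<open>\<Sigma>\<close> is a finite type \<^typ>\<open>'a\<close>, so \<open>m = CARD('a)\<close>, and vectors and matrices over
  \<open>\<int>\<close> are indexed by the letters themselves rather than by \<open>1, \<dots>, m\<close>.  Finite words are lists,
  infinite words are functions on \<^typ>\<open>nat\<close>.
\<close>

definition morphism :: "('a list \<Rightarrow> 'a list) \<Rightarrow> bool" where
  "morphism h \<longleftrightarrow> h [] = [] \<and> (\<forall>u v. h (u @ v) = h u @ h v)"

definition is_prefix :: "'a list \<Rightarrow> 'a word \<Rightarrow> bool" where
  "is_prefix u w \<longleftrightarrow> (\<exists>y. w = u \<frown> y)"

definition is_factor :: "'a list \<Rightarrow> 'a word \<Rightarrow> bool" where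
  "is_factor u w \<longleftrightarrow> (\<exists>p y. w = p \<frown> u \<frown> y)"

text \<open>Only meaningful when such a word exists uniquely; lemma \<open>morphic_word_unique\<close> below
  shows that it does when \<open>h\<close> is prolongable on \<open>s\<close> and maps no letter to the empty word.\<close>

definition morphic_word :: "('a list \<Rightarrow> 'a list) \<Rightarrow> 'a \<Rightarrow> 'a word" where
  "morphic_word h s = (THE w. \<forall>n. is_prefix ((h ^^ n) [s]) w)"

definition max_image :: "('a::finite list \<Rightarrow> 'a list) \<Rightarrow> nat" where
  "max_image h = Max (range (\<lambda>c. length (h [c])))"

text \<open>Parikh vectors have natural entries; they are cast to \<open>\<int>\<close> since only their differences are used.\<close>

definition parikh :: "'a::finite list \<Rightarrow> int ^ 'a" where
  "parikh u = (\<chi> c. int (count_list u c))"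

definition frequency_matrix :: "('a::finite list \<Rightarrow> 'a list) \<Rightarrow> int ^ 'a ^ 'a" where
  "frequency_matrix h = (\<chi> c. parikh (h [c]))"

definition dot :: "int ^ 'a \<Rightarrow> int ^ 'a \<Rightarrow> int" where
  "dot v w = (\<Sum>c\<in>UNIV. v $ c * w $ c)"

text \<open>
  A template is a pair of lists \<open>(a, d)\<close>.  Elements of \<open>\<Sigma> \<union> {\<epsilon>}\<close> are words of length at most 1.
  All indices are shifted down by one: \<open>a\<^sub>i\<close> is \<open>a ! (i - 1)\<close>, and likewise for \<open>d\<close>, \<open>X\<close>, \<open>p'\<close>, \<open>p''\<close>.
\<close>

type_synonym 'a template = "'a list list \<times> (int ^ 'a) list"

definition is_template :: "nat \<Rightarrow> 'a::finite template \<Rightarrow> bool" where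
  "is_template k = (\<lambda>(a, d). k \<ge> 2 \<and> length a = k + 1 \<and> length d = k - 1 \<and>
     (\<forall>u \<in> set a. length u \<le> 1))"

definition is_instance :: "nat \<Rightarrow> 'a::finite template \<Rightarrow> 'a list \<Rightarrow> bool" where
  "is_instance k = (\<lambda>(a, d) w. \<exists>X. length X = k \<and>
     w = concat (map (\<lambda>i. a ! i @ X ! i) [0..<k]) @ a ! k \<and>
     (\<forall>i < k - 1. parikh (X ! (i + 1)) - parikh (X ! i) = d ! i))"

definition is_parent ::
  "nat \<Rightarrow> ('a::finite list \<Rightarrow> 'a list) \<Rightarrow> 'a template \<Rightarrow> 'a template \<Rightarrow> bool" where
  "is_parent k h = (\<lambda>(A, D) (a, d). is_template k (A, D) \<and>
     (\<exists>p' p''. length p' = k + 1 \<and> length p'' = k + 1 \<and>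
       (\<forall>i < k + 1. h (A ! i) = p' ! i @ a ! i @ p'' ! i) \<and>
       (\<forall>j < k - 1. parikh (p'' ! (j + 1) @ p' ! (j + 2)) - parikh (p'' ! j @ p' ! (j + 1))
                      + D ! j v* frequency_matrix h = d ! j)))"

lemma morphic_word_unique:
  assumes "morphism h" and "h [s] = s # x" and "x \<noteq> []" and "\<And>c. h [c] \<noteq> []"
  shows "\<exists>!w. \<forall>n. is_prefix ((h ^^ n) [s]) w"
proof -
  have app: "h (u @ v) = h u @ h v" for u v
    using assms(1) by (auto simp: morphism_def)
  have len: "length u \<le> length (h u)" for u
  proof (induction u)
    case (Cons c u)
    then show ?case using app[of "[c]" u] assms(4)[of c]
      by (cases "h [c]") auto
  qed simp
  have ne: "h u \<noteq> []" if "u \<noteq> []" for u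
    using len[of u] that by (cases "h u") auto
  have appn: "(h ^^ n) (u @ v) = (h ^^ n) u @ (h ^^ n) v" for n u v
    by (induction n) (auto simp: app)
  have nen: "(h ^^ n) x \<noteq> []" for n
    by (induction n) (auto simp: assms(3) ne)
  define W where "W n = (h ^^ n) [s]" for n
  have step: "W (Suc n) = W n @ (h ^^ n) x" for n
    using appn[of n "[s]" x] assms(2) by (simp add: W_def funpow_swap1)
  have lenW: "n < length (W n)" for n
  proof (induction n)
    case 0
    then show ?case by (simp add: W_def)
  next
    case (Suc n)
    then show ?case using nen[of n] by (cases "(h ^^ n) x") (auto simp: step)
  qed
  have ext: "\<exists>y. W (n + d) = W n @ y" for n d
    by (induction d) (auto simp: step)
  have same: "W n ! i = W i ! i" if "i < length (W n)" for n i
  proof (cases "i \<le> n")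
    case True
    then show ?thesis using ext[of i "n - i"] lenW[of i] by (auto simp: nth_append)
  next
    case False
    then show ?thesis using ext[of n "i - n"] that by (auto simp: nth_append)
  qed
  define w where "w = (\<lambda>i. W i ! i)"
  have "is_prefix (W n) w" for n
    unfolding is_prefix_def
    by (rule exI[of _ "suffix (length (W n)) w"])
      (auto simp: w_def conc_def fun_eq_iff same)
  moreover have "v = w" if "\<forall>n. is_prefix (W n) v" for v
  proof
    fix i
    have "is_prefix (W i) v" using that by blast
    then obtain y where "v = W i \<frown> y" unfolding is_prefix_def by blast
    then show "v i = w i" using lenW[of i] by (simp add: w_def)
  qed
  ultimately show ?thesis unfolding W_def by blast
qed

end

theory Submission
  imports Defs
begin

text \<open>
  Write \<open>w\<close> for the morphic word and cut it into the blocks \<open>h (w 0)\<close>, \<open>h (w 1)\<close>, \<dots>; consecutive cut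
  points are at distance at most \<open>N\<close>.  Widen every occurrence of an \<open>a\<^sub>i\<close> in \<open>I\<close> outwards to the
  nearest cut points: since \<open>a\<^sub>i\<close> has length at most 1, the result is \<open>h A\<^sub>i\<close> with \<open>A\<^sub>i\<close> a letter or
  empty.  The lengths of the \<open>X\<^sub>i\<close> differ by sums of the \<open>d\<^sub>r \<cdot> (1,\<dots>,1)\<close>, so the lower bound on
  \<open>|I|\<close> forces \<open>|X\<^sub>i| \<ge> N - 1\<close> for all \<open>i\<close>, and hence the widened occurrences do not overlap.  The
  preimage \<open>J\<close> is an instance of the resulting parent, and \<open>2 |J| \<le> |h J| \<le> |I| + 2 (N - 1)\<close>
  gives \<open>|J| < |I|\<close>.
\<close>

section \<open>Finite words as segments \<open>map w [i..<j]\<close> of an infinite word\<close>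

lemma map_upt_append:
  fixes i j l :: nat
  assumes "i \<le> j" "j \<le> l"
  shows "map f [i..<j] @ map f [j..<l] = map f [i..<l]"
  using assms by (metis le_add_diff_inverse map_append upt_add_eq_append)

lemma append_eq_map_upt:
  fixes i j :: nat
  assumes "u @ v = map f [i..<j]"
  shows "u = map f [i..<i + length u]" "v = map f [i + length u..<j]"
proof -
  have len: "length u + length v = j - i"
    using arg_cong[OF assms, of length] by simp
  have "map f [i..<j] = map f [i..<i + length u] @ map f [i + length u..<j]"
  proof (cases "i \<le> j")
    case True
    then show ?thesis using len by (intro map_upt_append[symmetric]) auto
  qed (use len in auto)
  with assms have "u @ v = map f [i..<i + length u] @ map f [i + length u..<j]"
    by simp
  then show "u = map f [i..<i + length u]" "v = map f [i + length u..<j]"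
    by (auto simp: append_eq_append_conv)
qed

text \<open>Adjacent segments glue only when the cut points are ordered, so the induction carries
  \<open>p 0 \<le> p n\<close> along.\<close>

lemma concat_map_upt_eq_map_upt:
  fixes p :: "nat \<Rightarrow> nat"
  assumes "\<And>i. i < n \<Longrightarrow> p i \<le> p (Suc i)"
    and "\<And>i. i < n \<Longrightarrow> g i = map f [p i..<p (Suc i)]"
  shows "concat (map g [0..<n]) = map f [p 0..<p n] \<and> p 0 \<le> p n"
  using assms
proof (induction n)
  case (Suc n)
  have "concat (map g [0..<n]) = map f [p 0..<p n]" "p 0 \<le> p n"
    using Suc.IH Suc.prems by (simp_all add: less_SucI)
  moreover have "p n \<le> p (Suc n)" using Suc.prems by simp
  ultimately show ?case using Suc.prems(2)[of n] by (simp add: map_upt_append)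
qed simp

text \<open>Serves to locate the pieces of \<open>I\<close> in the infinite word: each one starts at
  \<open>q\<close> plus the total length of its predecessors.\<close>

lemma concat_append_eq_map_upt:
  fixes q j :: nat
  assumes "concat (map g [0..<n]) @ r = map f [q..<j]"
    and "i < n"
  defines "p \<equiv> \<lambda>i. q + length (concat (map g [0..<i]))"
  shows "g i = map f [p i..<p (Suc i)]"
proof -
  have "[0..<n] = [0..<i] @ i # [Suc i..<n]"
    using assms(2) by (metis add_0 less_imp_add_positive upt_add_eq_append upt_conv_Cons zero_le less_imp_le_nat)
  then have "concat (map g [0..<i]) @ (g i @ (concat (map g [Suc i..<n]) @ r)) = map f [q..<j]"
    using assms(1) by simp
  then have "g i @ (concat (map g [Suc i..<n]) @ r) = map f [p i..<j]"
    unfolding p_def by (rule append_eq_map_upt(2))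
  then have "g i = map f [p i..<p i + length (g i)]"
    by (rule append_eq_map_upt(1))
  then show ?thesis by (simp add: p_def add.assoc)
qed

lemma is_prefix_iff: "is_prefix u w \<longleftrightarrow> u = map w [0..<length u]"
proof
  assume "is_prefix u w"
  then show "u = map w [0..<length u]"
    by (auto simp: is_prefix_def conc_def intro!: nth_equalityI)
next
  assume "u = map w [0..<length u]"
  then have "w = u \<frown> suffix (length u) w"
    by (metis prefix_suffix subsequence_def)
  then show "is_prefix u w" unfolding is_prefix_def by blast
qed

lemma is_factor_iff: "is_factor u w \<longleftrightarrow> (\<exists>i. u = map w [i..<i + length u])"
proof
  assume "is_factor u w"
  then obtain p y where "w = p \<frown> u \<frown> y" unfolding is_factor_def by blast
  then have "u = map w [length p..<length p + length u]"
    by (auto simp: conc_def intro!: nth_equalityI)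
  then show "\<exists>i. u = map w [i..<i + length u]" by blast
next
  assume "\<exists>i. u = map w [i..<i + length u]"
  then obtain i where u: "u = map w [i..<i + length u]" by blast
  have "u ! n = w (i + n)" if "n < length u" for n
    using that by (subst u) simp
  then have "w = map w [0..<i] \<frown> u \<frown> suffix (i + length u) w"
    by (auto simp: conc_def fun_eq_iff)
  then show "is_factor u w" unfolding is_factor_def by blast
qed

section \<open>Parikh vectors and the lengths of the \<open>X ! i\<close>\<close>

lemma parikh_append: "parikh (u @ v) = parikh u + parikh v"
  by (simp add: parikh_def vec_eq_iff)

lemma dot_parikh_1: "dot (parikh u) 1 = int (length u)"
  by (simp add: dot_def parikh_def sum_count_set flip: of_nat_sum)

lemma dot_diff_left: "dot (u - v) w = dot u w - dot v w"
  by (simp add: dot_def left_diff_distrib sum_subtractf)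

text \<open>In \<open>int ^ 'a\<close>, \<open>1\<close> is the all-ones vector; dotting with it
  turns Parikh vectors into lengths, and the sum telescopes.\<close>

lemma length_diff_eq_sum_dot:
  assumes "\<And>i. i < k - 1 \<Longrightarrow> parikh (X ! Suc i) - parikh (X ! i) = d ! i"
    and "i \<le> j" "j < k"
  shows "int (length (X ! j)) - int (length (X ! i)) = (\<Sum>r = i..<j. dot (d ! r) 1)"
proof -
  have "dot (d ! r) 1 = int (length (X ! Suc r)) - int (length (X ! r))" if "r < j" for r
    using assms(3) that by (subst assms(1)[symmetric]) (auto simp: dot_diff_left dot_parikh_1)
  then have "(\<Sum>r = i..<j. dot (d ! r) 1)
      = (\<Sum>r = i..<j. int (length (X ! Suc r)) - int (length (X ! r)))"
    by (intro sum.cong) auto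
  also have "\<dots> = int (length (X ! j)) - int (length (X ! i))"
    using assms(2) by (rule sum_Suc_diff')
  finally show ?thesis by simp
qed

lemma length_gap_le_Max:
  assumes "\<And>i. i < k - 1 \<Longrightarrow> parikh (X ! Suc i) - parikh (X ! i) = d ! i"
    and "i < k" "j < k" "i \<noteq> j"
  shows "int (length (X ! i))
    \<le> int (length (X ! j)) + Max {\<bar>\<Sum>r = i..<j. dot (d ! r) 1\<bar> | i j. i < j \<and> j < k}"
proof -
  let ?S = "{\<bar>\<Sum>r = i..<j. dot (d ! r) 1\<bar> | i j. i < j \<and> j < k}"
  have "?S \<subseteq> (\<lambda>(i, j). \<bar>\<Sum>r = i..<j. dot (d ! r) 1\<bar>) ` ({..<k} \<times> {..<k})"
    by force
  then have "finite ?S" by (rule finite_subset) simp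
  moreover have "\<bar>int (length (X ! i)) - int (length (X ! j))\<bar> \<in> ?S"
  proof (cases "i < j")
    case True
    then have "\<bar>int (length (X ! i)) - int (length (X ! j))\<bar> = \<bar>\<Sum>r = i..<j. dot (d ! r) 1\<bar>"
      using length_diff_eq_sum_dot[OF assms(1) _ assms(3), of i] by linarith
    then show ?thesis using True assms(3) by blast
  next
    case False
    then have "j < i" using assms(4) by simp
    then have "\<bar>int (length (X ! i)) - int (length (X ! j))\<bar> = \<bar>\<Sum>r = j..<i. dot (d ! r) 1\<bar>"
      using length_diff_eq_sum_dot[OF assms(1) _ assms(2), of j] by linarith
    then show ?thesis using \<open>j < i\<close> assms(2) by blast
  qed
  ultimately have "\<bar>int (length (X ! i)) - int (length (X ! j))\<bar> \<le> Max ?S" by simp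
  then show ?thesis by linarith
qed

section \<open>The morphism and its action on the morphic word\<close>

lemma morphism_append: "morphism h \<Longrightarrow> h (u @ v) = h u @ h v"
  by (simp add: morphism_def)

text \<open>Both sides are additive in \<open>u\<close>; on a single letter, the unit vector selects
  the corresponding row of the matrix.\<close>

lemma parikh_morphism:
  assumes "morphism h"
  shows "parikh (h u) = parikh u v* frequency_matrix h"
proof (induction u)
  case Nil
  then show ?case
    using assms by (simp add: morphism_def parikh_def vector_matrix_mult_def vec_eq_iff)
next
  case (Cons c u)
  have "parikh [c] v* frequency_matrix h = parikh (h [c])"
    by (simp add: vector_matrix_mult_def vec_eq_iff frequency_matrix_def parikh_def
        if_distrib[of "\<lambda>z. z * _"] if_distrib[of int] cong: if_cong)
  then show ?case
    using Cons morphism_append[OF assms, of "[c]" u] parikh_append[of "[c]" u]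
    by (simp add: parikh_append vector_matrix_left_distrib)
qed

lemma length_morphism_ge:
  assumes "morphism h" "\<And>c. length (h [c]) > 1"
  shows "2 * length u \<le> length (h u)"
proof (induction u)
  case (Cons c u)
  then show ?case
    using morphism_append[OF assms(1), of "[c]" u] assms(2)[of c] by simp
qed simp

lemma length_image_le_max_image: "length (h [c]) \<le> max_image h"
  unfolding max_image_def by (rule Max_ge) auto

text \<open>This is the fixed-point equation \<open>h w = w\<close>, read on segments. The first
  \<open>n\<close> letters of \<open>w\<close> lie in the \<open>n\<close>-th iterate, and its
  image, the next iterate, is again a prefix of \<open>w\<close>.\<close>

lemma map_image_morphic_word:
  fixes h :: "'a::finite list \<Rightarrow> 'a list" and s :: 'a
  assumes h: "morphism h" and s: "h [s] = s # x" "x \<noteq> []"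
    and ge: "\<And>c. length (h [c]) > 1"
  defines "w \<equiv> morphic_word h s"
  defines "B \<equiv> \<lambda>n. length (h (map w [0..<n]))"
  assumes "m \<le> n"
  shows "B m \<le> B n" and "h (map w [m..<n]) = map w [B m..<B n]"
proof -
  have ne: "h [c] \<noteq> []" for c using ge[of c] by auto
  have "\<forall>n. is_prefix ((h ^^ n) [s]) w"
    unfolding w_def morphic_word_def
    using theI'[OF morphic_word_unique[OF h s ne]] .
  then have pre: "(h ^^ n) [s] = map w [0..<length ((h ^^ n) [s])]" for n
    by (simp add: is_prefix_iff)
  have long: "n < length ((h ^^ n) [s])" for n
  proof (induction n)
    case (Suc n)
    then show ?case using length_morphism_ge[OF h ge, of "(h ^^ n) [s]"] by simp
  qed simp
  have init: "h (map w [0..<n]) = map w [0..<B n]" for n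
  proof -
    let ?L = "length ((h ^^ n) [s])"
    have "h (map w [0..<n]) @ h (map w [n..<?L]) = h ((h ^^ n) [s])"
      using pre[of n] long[of n] by (metis le0 less_imp_le map_upt_append morphism_append[OF h])
    also have "\<dots> = map w [0..<length ((h ^^ Suc n) [s])]"
      using pre[of "Suc n"] by simp
    finally show ?thesis
      using append_eq_map_upt(1) B_def by fastforce
  qed
  have split: "map w [0..<B m] @ h (map w [m..<n]) = map w [0..<B n]"
    using map_upt_append[of 0 m n w] \<open>m \<le> n\<close> init morphism_append[OF h]
    by (metis le0)
  show "B m \<le> B n" using arg_cong[OF split, of length] by simp
  show "h (map w [m..<n]) = map w [B m..<B n]"
    using append_eq_map_upt(2)[OF split] by simp
qed

theorem lemma3p5:
  fixes h :: "'a::finite list \<Rightarrow> 'a list"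
    and s :: 'a
    and x :: "'a list"
    and k :: nat
    and a :: "'a list list"
    and d :: "(int ^ 'a) list"
    and I :: "'a list"
  assumes "morphism h"
    and "h [s] = s # x" and "x \<noteq> []"
    and "\<And>c. length (h [c]) > 1"
    and "k \<ge> 2"
    and "is_template k (a, d)"
    and "is_factor I (morphic_word h s)"
    and "is_instance k (a, d) I"
    and "int (length I) > int (max_image h) + int k - 1
           + (int k - 1) * (int (max_image h) - 2
               + Max {\<bar>\<Sum>r = i..<j. dot (d ! r) 1\<bar> | i j. i < j \<and> j < k})"
  shows "\<exists>t\<^sub>1 J. is_parent k h t\<^sub>1 (a, d) \<and> is_factor J (morphic_word h s)
           \<and> is_instance k t\<^sub>1 J \<and> length J < length I"
proof -
  define w where "w = morphic_word h s"
  define N where "N = max_image h"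
  define Mx where "Mx = Max {\<bar>\<Sum>r = i..<j. dot (d ! r) 1\<bar> | i j. i < j \<and> j < k}"
  have big: "int (length I) > int N + int k - 1 + (int k - 1) * (int N - 2 + Mx)"
    using assms(9) unfolding N_def Mx_def .
  have N2: "N \<ge> 2"
    using assms(4)[of s] length_image_le_max_image[of h s] unfolding N_def by linarith
  obtain X where X: "length X = k"
    and I: "I = concat (map (\<lambda>i. a ! i @ X ! i) [0..<k]) @ a ! k"
    and Xd: "\<And>i. i < k - 1 \<Longrightarrow> parikh (X ! Suc i) - parikh (X ! i) = d ! i"
    using assms(8) by (auto simp: is_instance_def)
  have a1: "length (a ! i) \<le> 1" if "i \<le> k" for i
    using assms(6) that by (auto simp: is_template_def)
  have gap: "int (length (X ! i)) \<le> int (length (X ! j)) + Mx" if "i < k" "j < k" "i \<noteq> j" for i j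
    using length_gap_le_Max[OF Xd] that unfolding Mx_def by blast
  \<comment> \<open>Adding the two gap inequalities gives \<open>0 \<le> 2 * Mx\<close>.\<close>
  have Mx0: "Mx \<ge> 0"
    using gap[of 0 1] gap[of 1 0] \<open>k \<ge> 2\<close> by linarith
  \<comment> \<open>If some \<open>X ! i\<close> had length at most \<open>N - 2\<close>, the other
    \<open>k - 1\<close> would have length at most \<open>N - 2 + Mx\<close>; with at most
    \<open>k + 1\<close> letters from the \<open>a ! j\<close>, the total could not exceed the bound
    in \<open>big\<close>.\<close>
  have longX: "N - 1 \<le> length (X ! i)" if "i < k" for i
  proof (rule ccontr)
    assume "\<not> ?thesis"
    then have short: "int (length (X ! i)) \<le> int N - 2" using N2 by linarith
    have "int (length I) = (\<Sum>j<k. int (length (a ! j)) + int (length (X ! j))) + int (length (a ! k))"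
      by (simp add: I length_concat comp_def atLeast0LessThan interv_sum_list_conv_sum_set_nat)
    also have "\<dots> = (\<Sum>j<k. int (length (a ! j))) + (\<Sum>j<k. int (length (X ! j))) + int (length (a ! k))"
      by (simp add: sum.distrib)
    also have "(\<Sum>j<k. int (length (a ! j))) \<le> (\<Sum>j<k. 1)"
      using a1 by (intro sum_mono) (simp add: less_imp_le)
    also have "(\<Sum>j<k. int (length (X ! j)))
        = int (length (X ! i)) + (\<Sum>j\<in>{..<k} - {i}. int (length (X ! j)))"
      using that by (subst sum.remove[of _ i]) auto
    also have "(\<Sum>j\<in>{..<k} - {i}. int (length (X ! j))) \<le> (\<Sum>j\<in>{..<k} - {i}. int N - 2 + Mx)"
      using gap[of _ i] short that by (intro sum_mono) force
    also have "\<dots> = (int k - 1) * (int N - 2 + Mx)"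
      using that by (simp add: of_nat_diff)
    finally show False using big short a1[of k] by simp
  qed

  \<comment> \<open>\<open>B n\<close> is the cut point at which the block \<open>h [w n]\<close>
    starts in \<open>w\<close>.\<close>
  define B where "B n = length (h (map w [0..<n]))" for n
  have mono_B: "B m \<le> B n" and hw: "h (map w [m..<n]) = map w [B m..<B n]" if "m \<le> n" for m n
    using map_image_morphic_word[OF assms(1-4) that] unfolding B_def w_def by auto
  have B0: "B 0 = 0" using assms(1) by (simp add: B_def morphism_def)
  have "B (Suc n) = B n + length (h [w n])" for n
    by (simp add: B_def morphism_append[OF assms(1)])
  then have B_Suc: "B n < B (Suc n)" "B (Suc n) \<le> B n + N" for n
    using assms(4)[of "w n"] length_image_le_max_image[of h "w n"] unfolding N_def by auto
  have strict_B: "strict_mono B" using B_Suc(1) by (rule strict_mono_Suc_iff[THEN iffD2, rule_format])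
  have B_ge: "n \<le> B n" for n using strict_B by (rule strict_mono_imp_increasing)

  obtain q where q: "I = map w [q..<q + length I]"
    using assms(7) unfolding is_factor_iff w_def by blast
  \<comment> \<open>For \<open>i \<le> k\<close>, \<open>a ! i\<close> occupies the positions from
    \<open>b i\<close> up to, but excluding, \<open>e i\<close>.\<close>
  define b where "b i = q + length (concat (map (\<lambda>i. a ! i @ X ! i) [0..<i]))" for i
  define e where "e i = b i + length (a ! i)" for i
  have b_Suc: "b (Suc i) = e i + length (X ! i)" for i by (simp add: b_def e_def)
  have Iw: "concat (map (\<lambda>i. a ! i @ X ! i) [0..<k]) @ a ! k = map w [q..<q + length I]"
    using q I by simp
  have "a ! i @ X ! i = map w [b i..<b (Suc i)]" if "i < k" for i
    using concat_append_eq_map_upt[OF Iw that] by (simp add: b_def)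
  then have aw': "a ! i = map w [b i..<e i]" and Xw: "X ! i = map w [e i..<b (Suc i)]" if "i < k" for i
    using append_eq_map_upt that unfolding e_def by blast+
  have ek: "e k = q + length I" by (simp add: e_def b_def I)
  have aw: "a ! i = map w [b i..<e i]" if "i \<le> k" for i
  proof (cases "i < k")
    case False
    then have "i = k" using that by simp
    moreover have "a ! k = map w [b k..<e k]"
      using append_eq_map_upt(2)[OF Iw] ek by (simp add: b_def)
    ultimately show ?thesis by simp
  qed (rule aw')

  \<comment> \<open>\<open>l i\<close> and \<open>u i\<close> index the nearest cut points around
    \<open>a ! i\<close>. They coincide exactly when \<open>a ! i\<close> is empty and sits on a cut
    point; then \<open>A ! i\<close> is empty too.\<close>
  define l where "l i = (GREATEST n. B n \<le> b i)" for i
  define u where "u i = (LEAST n. e i \<le> B n)" for i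
  have ex_l: "B 0 \<le> b i" and bd_l: "\<forall>n. B n \<le> b i \<longrightarrow> n \<le> b i" for i
    using B0 B_ge by (simp, meson le_trans)
  have Bl: "B (l i) \<le> b i" for i
    unfolding l_def using GreatestI_nat[where P = "\<lambda>n. B n \<le> b i", OF ex_l] bd_l by blast
  have l_max: "n \<le> l i" if "B n \<le> b i" for i n
    unfolding l_def using Greatest_le_nat[where P = "\<lambda>n. B n \<le> b i", OF that] bd_l by blast
  have Bu: "e i \<le> B (u i)" for i
    unfolding u_def by (rule LeastI[where P = "\<lambda>n. e i \<le> B n", OF B_ge])
  have u_min: "u i \<le> n" if "e i \<le> B n" for i n
    unfolding u_def using that by (rule Least_le)
  \<comment> \<open>The preceding cut point lies strictly before \<open>e i\<close>, and a block has
    length at most \<open>N\<close>.\<close>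
  have Bu_le: "B (u i) \<le> e i + (N - 1)" for i
  proof (cases "u i")
    case (Suc n)
    then have "B n < e i" using u_min[of i n] by fastforce
    then show ?thesis using B_Suc(2)[of n] Suc N2 by simp
  qed (simp add: B0)
  have Bl_ge: "b i < B (Suc (l i))" for i
    using l_max[of "Suc (l i)" i] by fastforce
  have be: "b i \<le> e i" for i by (simp add: e_def)
  have lu: "l i \<le> u i" for i
    using Bl[of i] Bu[of i] be[of i] strict_mono_less_eq[OF strict_B] by (meson le_trans)
  \<comment> \<open>As \<open>a ! i\<close> has at most one letter, it ends no later than the block
    containing position \<open>b i\<close>.\<close>
  have ul: "u i \<le> Suc (l i)" if "i \<le> k" for i
    using u_min[of i "Suc (l i)"] Bl_ge[of i] a1[OF that] unfolding e_def by simp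
  \<comment> \<open>\<open>X ! i\<close> is long enough to absorb the overshoot of at most
    \<open>N - 1\<close> past \<open>e i\<close>.\<close>
  have u_l: "u i \<le> l (Suc i)" if "i < k" for i
    using l_max[of "u i" "Suc i"] Bu_le[of i] longX[OF that] b_Suc[of i] by simp

  define A where "A = map (\<lambda>i. map w [l i..<u i]) [0..<k + 1]"
  define Y where "Y = map (\<lambda>i. map w [u i..<l (Suc i)]) [0..<k]"
  \<comment> \<open>This choice makes \<open>J\<close> an instance outright; the parent equation is
    what remains to be checked.\<close>
  define D where "D = map (\<lambda>i. parikh (Y ! Suc i) - parikh (Y ! i)) [0..<k - 1]"
  define P where "P = map (\<lambda>i. map w [B (l i)..<b i]) [0..<k + 1]"
  define Q where "Q = map (\<lambda>i. map w [e i..<B (u i)]) [0..<k + 1]"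
  have nths: "A ! i = map w [l i..<u i]" "P ! i = map w [B (l i)..<b i]"
    "Q ! i = map w [e i..<B (u i)]" if "i \<le> k" for i
    using that by (auto simp: A_def P_def Q_def simp del: upt_Suc)
  have Ynth: "Y ! i = map w [u i..<l (Suc i)]" if "i < k" for i
    using that by (simp add: Y_def)
  have hA: "h (A ! i) = P ! i @ a ! i @ Q ! i" if "i \<le> k" for i
    using that by (simp add: nths hw lu aw map_upt_append Bl Bu be le_trans[OF be Bu])
  have hY: "X ! i = Q ! i @ h (Y ! i) @ P ! Suc i" if "i < k" for i
  proof -
    have "B (u i) \<le> B (l (Suc i))" using u_l[OF that] by (rule mono_B)
    then show ?thesis
      using that Bl[of "Suc i"] Bu[of i]
      by (simp add: nths Ynth hw u_l Xw map_upt_append)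
  qed
  \<comment> \<open>Split both Parikh vectors in \<open>Xd\<close> according to \<open>hY\<close>;
    the terms from \<open>h (Y ! i)\<close> combine to \<open>D ! j\<close> times the
    matrix.\<close>
  have "parikh (Q ! (j + 1) @ P ! (j + 2)) - parikh (Q ! j @ P ! (j + 1))
      + D ! j v* frequency_matrix h = d ! j" if "j < k - 1" for j
  proof -
    have "D ! j v* frequency_matrix h = parikh (h (Y ! Suc j)) - parikh (h (Y ! j))"
      using that by (simp add: D_def parikh_morphism[OF assms(1)] vector_matrix_mult_diff_distrib)
    moreover have "j < k" "Suc j < k" using that by auto
    ultimately show ?thesis
      by (simp add: Xd[OF that, symmetric] hY parikh_append)
  qed
  moreover have "length P = k + 1" "length Q = k + 1"
    by (simp_all add: P_def Q_def)
  moreover have "is_template k (A, D)"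
    using \<open>k \<ge> 2\<close> ul by (auto simp: is_template_def A_def D_def le_diff_conv simp del: upt_Suc)
  ultimately have parent: "is_parent k h (A, D) (a, d)"
    unfolding is_parent_def prod.case using hA
    by (intro conjI exI[of _ P] exI[of _ Q]) auto

  define J where "J = map w [l 0..<u k]"
  have AY: "A ! i @ Y ! i = map w [l i..<l (Suc i)]" and l_mono: "l i \<le> l (Suc i)" if "i < k" for i
    using that lu[of i] u_l[OF that] by (simp_all add: nths Ynth map_upt_append)
  have l0k: "l 0 \<le> l k"
    and "concat (map (\<lambda>i. A ! i @ Y ! i) [0..<k]) = map w [l 0..<l k]"
    using concat_map_upt_eq_map_upt[of k l _ w, OF l_mono AY] by auto
  then have "J = concat (map (\<lambda>i. A ! i @ Y ! i) [0..<k]) @ A ! k"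
    using lu[of k] by (simp add: J_def nths map_upt_append)
  then have inst: "is_instance k (A, D) J"
    by (auto simp: is_instance_def D_def Y_def intro!: exI[of _ Y])
  have fact: "is_factor J w"
    unfolding is_factor_iff J_def using l0k lu[of k] by (intro exI[of _ "l 0"]) simp

  have "2 * length J \<le> length (h J)" using assms(1,4) by (rule length_morphism_ge)
  also have "\<dots> = B (u k) - B (l 0)"
    using hw[of "l 0" "u k"] l0k lu[of k] by (simp add: J_def)
  \<comment> \<open>\<open>h J\<close> extends \<open>I\<close> by at most \<open>N - 1\<close>
    letters on either side.\<close>
  also have "\<dots> \<le> length I + 2 * (N - 1)"
  proof -
    have "b 0 < B (l 0) + N" using Bl_ge[of 0] B_Suc(2)[of "l 0"] by simp
    moreover have "b 0 = q" by (simp add: b_def)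
    ultimately show ?thesis using Bu_le[of k] ek by linarith
  qed
  finally have "2 * length J \<le> length I + 2 * (N - 1)" .
  \<comment> \<open>Since \<open>k - 1 \<ge> 1\<close>, the bound in \<open>big\<close> is at least
    \<open>N + 1 + (N - 2)\<close>.\<close>
  moreover have "length I > 2 * (N - 1)"
  proof -
    have "1 * (int N - 2 + Mx) \<le> (int k - 1) * (int N - 2 + Mx)"
      using \<open>k \<ge> 2\<close> N2 Mx0 by (intro mult_right_mono) auto
    then have "int N + int k - 1 + (int N - 2 + Mx) < int (length I)"
      using big by simp
    then show ?thesis using Mx0 \<open>k \<ge> 2\<close> N2 by linarith
  qed
  ultimately have "length J < length I" by linarith
  then show ?thesis using parent inst fact unfolding w_def by blast
qed

end
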